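(* For any distributions $\mathcal V=\{\mathcal V_i\}_{i\in\mathcal N}$ of buyers' valuations in a non-Bayesian posted price auction and any $\epsilon,\tau>0$, there exist $K\in\mathrm{poly}\left(n,\frac1\epsilon,\log\frac1\tau\right)$ and $b\in\mathrm{poly}\left(\frac1\epsilon\right)$ such that, with probability at least $1-\tau$, the algorithm FIND-APX-PRICES run with inputs $K$ and $b$ returns $(p,r)$ satisfying $$\mathrm{Rev}(\mathcal V,p)\ge\max_{p'\in[0,1]^n}\mathrm{Rev}(\mathcal V,p')-\epsilon\quad\text{and}\quad r\in[\mathrm{Rev}(\mathcal V,p)-\epsilon,\ \mathrm{Rev}(\mathcal V,p)+\epsilon],$$ in time $\mathrm{poly}\left(n,\frac1\epsilon,\log\frac1\tau\right)$.
   Context: Non-Bayesian posted price auction: buyers $\mathcal N=\{1,\dots,n\}$ arrive in order $1,\dots,n$, with scalar valuations $v_i\in[0,1]$ drawn independently from distributions $\mathcal V_i$ on $[0,1]$. Given a price vector $p\in[0,1]^n$, buyer $i$ (if reached) buys at price $p_i$ if and only if $v_i\ge p_i$; the first buyer that buys ends the auction, with revenue equal to that buyer's price (revenue $0$ if nobody buys). $\mathrm{Rev}(\mathcal V,p)$ is the expected revenue. For $b\in\mathbb N_{>0}$, $P^b\subset[0,1]$ is the set of multiples of $1/b$ in $[0,1]$. Algorithm FIND-APX-PRICES, inputs $K,b\in\mathbb N_{>0}$, with access to an oracle for sampling from each $\mathcal V_i$: (1) for each $i\in\mathcal N$, draw $K$ i.i.d. samples from $\mathcal V_i$ and let $\mathcal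 V_i^K$ be their empirical distribution; (2) set $r\leftarrow 0$; (3) for $i=n,n-1,\dots,1$, set $$p_i\leftarrow\arg\max_{p_i'\in P^b}\ p_i'\Pr_{v_i\sim\mathcal V_i^K}\{v_i\ge p_i'\}+\big(1-\Pr_{v_i\sim\mathcal V_i^K}\{v_i\ge p_i'\}\big)r,$$ and then $r\leftarrow p_i\Pr_{v_i\sim\mathcal V_i^K}\{v_i\ge p_i\}+(1-\Pr_{v_i\sim\mathcal V_i^K}\{v_i\ge p_i\})r$; (4) return $(p,r)$ with $p=(p_1,\dots,p_n)$. The probability in the claim is over the samples. $\mathrm{poly}(\cdot)$ means bounded by a polynomial in the arguments (the same polynomial for all instances). *)

theory Defs
  imports "HOL-Probability.Probability" "HOL-Computational_Algebra.Polynomial"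
begin

section \<open>Posted price auctions\<close>

text \<open>Buyers are \<open>1, \<dots>, n\<close>; \<open>V i\<close> is the valuation distribution of buyer \<open>i\<close>, and price vectors and
  valuation profiles are functions of which only the values on \<open>{1..n}\<close> matter.\<close>

definition valuation_distribution :: "real measure \<Rightarrow> bool" where
  "valuation_distribution D \<longleftrightarrow> real_distribution D \<and> (AE x in D. x \<in> {0..1})"

definition revenue :: "nat \<Rightarrow> (nat \<Rightarrow> real) \<Rightarrow> (nat \<Rightarrow> real) \<Rightarrow> real" where
  "revenue n p v =
    (if \<exists>i\<in>{1..n}. v i \<ge> p i then p (LEAST i. i \<in> {1..n} \<and> v i \<ge> p i) else 0)"

definition Rev :: "nat \<Rightarrow> (nat \<Rightarrow> real measure) \<Rightarrow> (nat \<Rightarrow> real) \<Rightarrow> real" where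
  "Rev n V p = (\<integral>v. revenue n p v \<partial>PiM {1..n} V)"

definition price_vectors :: "nat \<Rightarrow> (nat \<Rightarrow> real) set" where
  "price_vectors n = {1..n} \<rightarrow>\<^sub>E {0..1}"

definition price_grid :: "nat \<Rightarrow> real set" where
  "price_grid b = {real j / real b | j. j \<le> b}"


section \<open>Samples\<close>

text \<open>\<open>\<omega> (i, k)\<close> is the answer to the \<open>k\<close>-th query (counting from 0) of the sampling oracle of
  buyer \<open>i\<close>.\<close>

definition sample_space :: "nat \<Rightarrow> nat \<Rightarrow> (nat \<Rightarrow> real measure) \<Rightarrow> (nat \<times> nat \<Rightarrow> real) measure" where
  "sample_space n K V = PiM ({1..n} \<times> {..<K}) (\<lambda>(i, k). V i)"

definition empirical :: "nat \<Rightarrow> (nat \<times> nat \<Rightarrow> real) \<Rightarrow> nat \<Rightarrow> real pmf" where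
  "empirical K \<omega> i = map_pmf (\<lambda>k. \<omega> (i, k)) (pmf_of_set {..<K})"


section \<open>Step counting\<close>

text \<open>Unit-cost model over the reals: every oracle query, arithmetic operation, comparison, and
  access to a list or array is charged one step by wrapping it in \<open>tick\<close>; \<open>ret\<close> is free and only
  passes on values that are already available.\<close>

datatype 'a timed = Timed (result: 'a) (steps: nat)

definition ret :: "'a \<Rightarrow> 'a timed" where
  "ret x = Timed x 0"

definition tick :: "'a \<Rightarrow> 'a timed" where
  "tick x = Timed x 1"

definition bind_timed :: "'a timed \<Rightarrow> ('a \<Rightarrow> 'b timed) \<Rightarrow> 'b timed" where
  "bind_timed m f = Timed (result (f (result m))) (steps m + steps (f (result m)))"

adhoc_overloading Monad_Syntax.bind \<rightleftharpoons> bind_timed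

lemma result_ret [simp]: "result (ret x) = x"
  and result_tick [simp]: "result (tick x) = x"
  and result_bind [simp]: "result (bind_timed m f) = result (f (result m))"
  and steps_ret [simp]: "steps (ret x) = 0"
  and steps_tick [simp]: "steps (tick x) = 1"
  and steps_bind [simp]: "steps (bind_timed m f) = steps m + steps (f (result m))"
  by (simp_all add: ret_def tick_def bind_timed_def)


section \<open>The algorithm FIND-APX-PRICES\<close>

fun draw_samples :: "(nat \<times> nat \<Rightarrow> real) \<Rightarrow> nat \<Rightarrow> nat \<Rightarrow> real list timed" where
  "draw_samples \<omega> i 0 = tick []"
| "draw_samples \<omega> i (Suc k) = do {
     vs \<leftarrow> draw_samples \<omega> i k;
     v \<leftarrow> tick (\<omega> (i, k));
     tick (v # vs)
   }"

fun draw_all :: "(nat \<times> nat \<Rightarrow> real) \<Rightarrow> nat \<Rightarrow> nat \<Rightarrow> (nat \<Rightarrow> real list) timed" where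
  "draw_all \<omega> K 0 = tick (\<lambda>_. [])"
| "draw_all \<omega> K (Suc i) = do {
     S \<leftarrow> draw_all \<omega> K i;
     vs \<leftarrow> draw_samples \<omega> (Suc i) K;
     tick (S(Suc i := vs))
   }"

fun count_ge :: "real \<Rightarrow> real list \<Rightarrow> nat timed" where
  "count_ge x [] = tick 0"
| "count_ge x (v # vs) = do {
     c \<leftarrow> count_ge x vs;
     ge \<leftarrow> tick (v \<ge> x);
     if ge then tick (c + 1) else tick c
   }"

definition price_value :: "nat \<Rightarrow> real list \<Rightarrow> real \<Rightarrow> real \<Rightarrow> real timed" where
  "price_value K vs r x = do {
     c \<leftarrow> count_ge x vs;
     q \<leftarrow> tick (real c / real K);
     s \<leftarrow> tick (x * q);
     q' \<leftarrow> tick (1 - q);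
     t \<leftarrow> tick (q' * r);
     tick (s + t)
   }"

text \<open>Scan of the candidate prices \<open>0/b, \<dots>, j/b\<close>, returning the best one together with its value.
  The \<open>arg max\<close> need not be unique: on a tie, \<open>\<sigma> j\<close> decides whether candidate \<open>j\<close> replaces the
  incumbent. By \<open>find_apx_prices_iff\<close> below, ranging over all rules \<open>\<sigma>\<close> covers all choices.\<close>

fun best_price :: "(nat \<Rightarrow> bool) \<Rightarrow> nat \<Rightarrow> nat \<Rightarrow> real list \<Rightarrow> real \<Rightarrow> nat \<Rightarrow> (real \<times> real) timed" where
  "best_price \<sigma> K b vs r 0 = do {
     x \<leftarrow> tick (real 0 / real b);
     u \<leftarrow> price_value K vs r x;
     ret (x, u)
   }"
| "best_price \<sigma> K b vs r (Suc j) = do {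
     (x, u) \<leftarrow> best_price \<sigma> K b vs r j;
     y \<leftarrow> tick (real (Suc j) / real b);
     w \<leftarrow> price_value K vs r y;
     better \<leftarrow> tick (w > u);
     tie \<leftarrow> tick (w = u);
     switch \<leftarrow> tick (\<sigma> (Suc j));
     if better \<or> (tie \<and> switch) then tick (y, w) else tick (x, u)
   }"

fun price_loop :: "(nat \<Rightarrow> nat \<Rightarrow> bool) \<Rightarrow> nat \<Rightarrow> nat \<Rightarrow> (nat \<Rightarrow> real list) \<Rightarrow>
    nat \<Rightarrow> (nat \<Rightarrow> real) \<Rightarrow> real \<Rightarrow> ((nat \<Rightarrow> real) \<times> real) timed" where
  "price_loop \<sigma> K b S 0 p r = tick (p, r)"
| "price_loop \<sigma> K b S (Suc i) p r = do {
     vs \<leftarrow> tick (S (Suc i));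
     (x, u) \<leftarrow> best_price (\<sigma> (Suc i)) K b vs r b;
     p' \<leftarrow> tick (p(Suc i := x));
     r' \<leftarrow> price_value K vs r x;
     price_loop \<sigma> K b S i p' r'
   }"

definition find_apx_prices :: "(nat \<Rightarrow> nat \<Rightarrow> bool) \<Rightarrow> (nat \<times> nat \<Rightarrow> real) \<Rightarrow> nat \<Rightarrow> nat \<Rightarrow> nat \<Rightarrow>
    ((nat \<Rightarrow> real) \<times> real) timed" where
  "find_apx_prices \<sigma> \<omega> n K b = do {
     S \<leftarrow> draw_all \<omega> K n;
     price_loop \<sigma> K b S n (\<lambda>_. 0) 0
   }"


section \<open>The possible outputs of the algorithm\<close>

definition empirical_value :: "nat \<Rightarrow> (nat \<times> nat \<Rightarrow> real) \<Rightarrow> nat \<Rightarrow> real \<Rightarrow> real \<Rightarrow> real" where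
  "empirical_value K \<omega> i r x =
    x * measure_pmf.prob (empirical K \<omega> i) {v. v \<ge> x} +
    (1 - measure_pmf.prob (empirical K \<omega> i) {v. v \<ge> x}) * r"

lemma result_draw_samples: "result (draw_samples \<omega> i k) = map (\<lambda>k. \<omega> (i, k)) (rev [0..<k])"
  by (induction k) auto

lemma result_draw_all:
  "result (draw_all \<omega> K n) i = (if i \<in> {1..n} then result (draw_samples \<omega> i K) else [])"
  by (induction n) auto

lemma result_count_ge: "result (count_ge x vs) = length (filter (\<lambda>v. v \<ge> x) vs)"
  by (induction vs) auto

lemma result_price_value:
  assumes "K > 0"
  shows "result (price_value K (result (draw_samples \<omega> i K)) r x) = empirical_value K \<omega> i r x"
proof -
  have "length (filter (\<lambda>v. v \<ge> x) (map (\<lambda>k. \<omega> (i, k)) (rev [0..<K])))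
      = length (filter (\<lambda>k. \<omega> (i, k) \<ge> x) (rev [0..<K]))"
    by (simp add: filter_map o_def)
  also have "\<dots> = card (set (filter (\<lambda>k. \<omega> (i, k) \<ge> x) (rev [0..<K])))"
    by (rule distinct_card [symmetric]) simp
  also have "set (filter (\<lambda>k. \<omega> (i, k) \<ge> x) (rev [0..<K])) = {..<K} \<inter> (\<lambda>k. \<omega> (i, k)) -` {v. v \<ge> x}"
    by auto
  finally have "result (count_ge x (result (draw_samples \<omega> i K)))
      = card ({..<K} \<inter> (\<lambda>k. \<omega> (i, k)) -` {v. v \<ge> x})"
    by (simp only: result_count_ge result_draw_samples)
  moreover have "measure_pmf.prob (empirical K \<omega> i) {v. v \<ge> x}
      = card ({..<K} \<inter> (\<lambda>k. \<omega> (i, k)) -` {v. v \<ge> x}) / K"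
    using assms by (simp add: empirical_def measure_pmf_of_set lessThan_empty_iff)
  ultimately show ?thesis
    by (simp add: price_value_def empirical_value_def)
qed

lemma best_price_sound:
  fixes f :: "real \<Rightarrow> real"
  assumes "\<And>x. result (price_value K vs r x) = f x"
  shows "\<exists>i\<le>j. result (best_price \<sigma> K b vs r j) = (real i / real b, f (real i / real b))
      \<and> (\<forall>k\<le>j. f (real k / real b) \<le> f (real i / real b))"
proof (induction j)
  case (Suc j)
  then obtain i where i: "i \<le> j" "result (best_price \<sigma> K b vs r j) = (real i / real b, f (real i / real b))"
    "\<forall>k\<le>j. f (real k / real b) \<le> f (real i / real b)"
    by blast
  show ?case
  proof (cases "fst (result (best_price \<sigma> K b vs r (Suc j))) = real (Suc j) / real b
      \<and> f (real (Suc j) / real b) \<ge> f (real i / real b)")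
    case True
    have "result (best_price \<sigma> K b vs r (Suc j)) = (real (Suc j) / real b, f (real (Suc j) / real b))"
      using True i(2) by (auto simp: assms split: if_splits)
    moreover have "\<forall>k\<le>Suc j. f (real k / real b) \<le> f (real (Suc j) / real b)"
      using True i(3) by (metis le_Suc_eq order.trans order_refl)
    ultimately show ?thesis by blast
  next
    case False
    then have "result (best_price \<sigma> K b vs r (Suc j)) = (real i / real b, f (real i / real b))"
        "f (real (Suc j) / real b) \<le> f (real i / real b)"
      using i(2) by (auto simp: assms split: if_splits)
    moreover have "\<forall>k\<le>Suc j. f (real k / real b) \<le> f (real i / real b)"
      using calculation i(3) by (metis le_Suc_eq)
    ultimately show ?thesis using i(1) by (meson le_SucI)
  qed
qed (auto simp: assms)

lemma best_price_complete:
  fixes f :: "real \<Rightarrow> real"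
  assumes f: "\<And>x. result (price_value K vs r x) = f x" and b: "b > 0"
    and max: "\<forall>k\<le>j. f (real k / real b) \<le> f (real i / real b)" and "i \<le> j"
  shows "result (best_price (\<lambda>k. k = i) K b vs r j) = (real i / real b, f (real i / real b))"
  using max \<open>i \<le> j\<close>
proof (induction j)
  case (Suc j)
  show ?case
  proof (cases "i = Suc j")
    case True
    obtain k where "k \<le> j"
      "result (best_price (\<lambda>k. k = i) K b vs r j) = (real k / real b, f (real k / real b))"
      using best_price_sound[OF f, of j "\<lambda>k. k = i" b] by blast
    moreover have "f (real k / real b) \<le> f (real i / real b)"
      using Suc.prems \<open>k \<le> j\<close> by simp
    ultimately show ?thesis using True by (auto simp: f)
  next
    case False
    then have "result (best_price (\<lambda>k. k = i) K b vs r j) = (real i / real b, f (real i / real b))"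
      using Suc by auto
    moreover have "f (real (Suc j) / real b) \<le> f (real i / real b)"
      using Suc.prems by blast
    ultimately show ?thesis using False by (auto simp: f)
  qed
qed (auto simp: f)

lemma best_price_iff:
  assumes "\<And>x. result (price_value K vs r x) = f x" and "b > 0"
  shows "(\<exists>\<sigma>. result (best_price \<sigma> K b vs r b) = (x, u)) \<longleftrightarrow>
    is_arg_max f (\<lambda>x. x \<in> price_grid b) x \<and> u = f x"
proof
  assume "\<exists>\<sigma>. result (best_price \<sigma> K b vs r b) = (x, u)"
  then obtain \<sigma> where \<sigma>: "result (best_price \<sigma> K b vs r b) = (x, u)" by blast
  show "is_arg_max f (\<lambda>x. x \<in> price_grid b) x \<and> u = f x"
    using best_price_sound[OF assms(1), of b \<sigma> b] \<sigma>
    by (fastforce simp: is_arg_max_linorder price_grid_def)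
next
  assume *: "is_arg_max f (\<lambda>x. x \<in> price_grid b) x \<and> u = f x"
  then obtain i where "i \<le> b" "x = real i / real b"
    by (auto simp: is_arg_max_linorder price_grid_def)
  with * show "\<exists>\<sigma>. result (best_price \<sigma> K b vs r b) = (x, u)"
    using best_price_complete[OF assms, of b i]
    by (fastforce simp: is_arg_max_linorder price_grid_def)
qed

inductive loop_output :: "nat \<Rightarrow> nat \<Rightarrow> (nat \<times> nat \<Rightarrow> real) \<Rightarrow>
    nat \<Rightarrow> (nat \<Rightarrow> real) \<Rightarrow> real \<Rightarrow> (nat \<Rightarrow> real) \<Rightarrow> real \<Rightarrow> bool" for K b \<omega> where
  "loop_output K b \<omega> 0 p r p r"
| "is_arg_max (empirical_value K \<omega> i r) (\<lambda>x. x \<in> price_grid b) x \<Longrightarrow>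
   loop_output K b \<omega> (i - 1) (p(i := x)) (empirical_value K \<omega> i r x) p' r' \<Longrightarrow> i > 0 \<Longrightarrow>
   loop_output K b \<omega> i p r p' r'"

lemma price_loop_cong:
  "(\<And>k. k \<in> {1..i} \<Longrightarrow> \<sigma> k = \<sigma>' k) \<Longrightarrow> price_loop \<sigma> K b S i p r = price_loop \<sigma>' K b S i p r"
proof (induction i arbitrary: p r)
  case (Suc i)
  have "\<sigma> (Suc i) = \<sigma>' (Suc i)" "price_loop \<sigma> K b S i = price_loop \<sigma>' K b S i"
    using Suc by (auto intro!: ext)
  then show ?case by simp
qed simp

lemma price_loop_iff:
  assumes "K > 0" "b > 0" and S: "\<And>k. k \<in> {1..i} \<Longrightarrow> S k = result (draw_samples \<omega> k K)"
  shows "(\<exists>\<sigma>. result (price_loop \<sigma> K b S i p r) = (p', r')) \<longleftrightarrow> loop_output K b \<omega> i p r p' r'"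
  using S
proof (induction i arbitrary: p r)
  case 0
  then show ?case by (auto elim: loop_output.cases intro: loop_output.intros)
next
  case (Suc i)
  let ?vs = "S (Suc i)" and ?f = "empirical_value K \<omega> (Suc i) r"
  have val: "result (price_value K ?vs r x) = ?f x" for x
    using Suc.prems[of "Suc i"] assms(1) by (simp add: result_price_value)
  have IH: "(\<exists>\<sigma>. result (price_loop \<sigma> K b S i p r) = (p', r')) \<longleftrightarrow> loop_output K b \<omega> i p r p' r'" for p r
    using Suc by auto
  have step: "result (price_loop \<sigma> K b S (Suc i) p r) =
      result (price_loop \<sigma> K b S i (p(Suc i := x)) (?f x))"
    if "result (best_price (\<sigma> (Suc i)) K b ?vs r b) = (x, u)" for \<sigma> x u
    using that by (simp add: val)
  show ?case
  proof
    assume "\<exists>\<sigma>. result (price_loop \<sigma> K b S (Suc i) p r) = (p', r')"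
    then obtain \<sigma> where \<sigma>: "result (price_loop \<sigma> K b S (Suc i) p r) = (p', r')" by blast
    obtain x u where xu: "result (best_price (\<sigma> (Suc i)) K b ?vs r b) = (x, u)"
      by fastforce
    then have "is_arg_max ?f (\<lambda>x. x \<in> price_grid b) x"
      using best_price_iff[OF val assms(2)] by blast
    moreover have "loop_output K b \<omega> i (p(Suc i := x)) (?f x) p' r'"
      using \<sigma> step[of \<sigma>, OF xu] IH by metis
    ultimately show "loop_output K b \<omega> (Suc i) p r p' r'"
      using loop_output.intros(2)[of K \<omega> "Suc i" r b x p p' r'] by simp
  next
    assume "loop_output K b \<omega> (Suc i) p r p' r'"
    then obtain x where x: "is_arg_max ?f (\<lambda>x. x \<in> price_grid b) x"
        "loop_output K b \<omega> i (p(Suc i := x)) (?f x) p' r'"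
      by (cases rule: loop_output.cases) auto
    obtain \<sigma>\<^sub>1 where \<sigma>\<^sub>1: "result (best_price \<sigma>\<^sub>1 K b ?vs r b) = (x, ?f x)"
      using best_price_iff[OF val assms(2)] x(1) by blast
    obtain \<sigma>\<^sub>2 where \<sigma>\<^sub>2: "result (price_loop \<sigma>\<^sub>2 K b S i (p(Suc i := x)) (?f x)) = (p', r')"
      using IH x(2) by blast
    let ?\<sigma> = "\<sigma>\<^sub>2(Suc i := \<sigma>\<^sub>1)"
    have "result (price_loop ?\<sigma> K b S (Suc i) p r) =
        result (price_loop ?\<sigma> K b S i (p(Suc i := x)) (?f x))"
      by (rule step) (use \<sigma>\<^sub>1 in simp)
    also have "price_loop ?\<sigma> K b S i (p(Suc i := x)) (?f x) = price_loop \<sigma>\<^sub>2 K b S i (p(Suc i := x)) (?f x)"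
      by (rule price_loop_cong) auto
    finally show "\<exists>\<sigma>. result (price_loop \<sigma> K b S (Suc i) p r) = (p', r')"
      using \<sigma>\<^sub>2 by metis
  qed
qed

theorem find_apx_prices_iff:
  assumes "K > 0" "b > 0"
  shows "(\<exists>\<sigma>. result (find_apx_prices \<sigma> \<omega> n K b) = (p, r)) \<longleftrightarrow>
    loop_output K b \<omega> n (\<lambda>_. 0) 0 p r"
  unfolding find_apx_prices_def result_bind
  by (rule price_loop_iff) (use assms in \<open>auto simp: result_draw_all\<close>)


section \<open>Polynomial bounds\<close>

definition polynomial3 :: "(real \<Rightarrow> real \<Rightarrow> real \<Rightarrow> real) \<Rightarrow> bool" where
  "polynomial3 f \<longleftrightarrow> (\<exists>d c. \<forall>x y z. f x y z =
    (\<Sum>i\<le>d. \<Sum>j\<le>d. \<Sum>k\<le>d. c i j k * x ^ i * y ^ j * z ^ k))"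

end

theory Submission
  imports Defs
begin

text \<open>Let \<open>q\<^sub>i(x)\<close> be the probability that buyer \<open>i\<close> accepts price \<open>x\<close>. The expected revenue is computed by
  the backward recursion \<open>r \<leftarrow> p\<^sub>i q\<^sub>i(p\<^sub>i) + (1 - q\<^sub>i(p\<^sub>i)) r\<close>, and the algorithm runs the same recursion
  with empirical probabilities. By Hoeffding's inequality and a union bound over buyers and grid prices,
  these are all within \<open>\<delta>\<close> of the true ones with high probability; each round then adds at most \<open>\<delta>\<close>
  to the error. Rounding prices to the grid costs \<open>1/b\<close> in total rather than per round: against an
  arbitrary price vector, the error changes only by a convex combination of \<open>1/b\<close> (if the buyer
  buys) and the error carried so far (if not), and a rounded price that falls below the continuation
  value \<open>r\<close> is no better than selling to nobody, which the grid price \<open>1\<close> matches. So \<open>\<delta> = \<epsilon> / (4 (n + 1))\<close>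
  and \<open>b \<approx> 2 / \<epsilon>\<close> suffice.\<close>

section \<open>The expected revenue\<close>

text \<open>Revenue as a scan from the last buyer to the first, with an accumulator \<open>r\<close>
  for what is earned if none of the remaining buyers buys. Earlier buyers overwrite later ones, so
  the first to accept determines the result. The order matches that of the price loop.\<close>

fun sale_price :: "nat \<Rightarrow> (nat \<Rightarrow> real) \<Rightarrow> real \<Rightarrow> (nat \<Rightarrow> real) \<Rightarrow> real" where
  "sale_price 0 p r v = r"
| "sale_price (Suc n) p r v =
     sale_price n p (if v (Suc n) \<ge> p (Suc n) then p (Suc n) else r) v"

lemma sale_price_eq:
  "sale_price n p r v =
    (if \<exists>i\<in>{1..n}. v i \<ge> p i then p (LEAST i. i \<in> {1..n} \<and> v i \<ge> p i) else r)"
proof (induction n arbitrary: r)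
  case (Suc n)
  show ?case
  proof (cases "\<exists>i\<in>{1..n}. v i \<ge> p i")
    case True
    define m where "m = (LEAST i. i \<in> {1..n} \<and> v i \<ge> p i)"
    have "m \<in> {1..n} \<and> v m \<ge> p m"
      unfolding m_def by (rule LeastI_ex) (use True in blast)
    moreover have "m \<le> y" if "y \<in> {1..n}" "v y \<ge> p y" for y
      unfolding m_def by (rule Least_le) (use that in blast)
    ultimately have "(LEAST i. i \<in> {1..Suc n} \<and> v i \<ge> p i) = m"
      by (intro Least_equality) (auto simp: le_Suc_eq)
    moreover have "\<exists>i\<in>{1..Suc n}. v i \<ge> p i"
      using True by auto
    ultimately show ?thesis
      using True by (simp only: sale_price.simps Suc.IH m_def if_True)
  next
    case False
    then have "(LEAST i. i \<in> {1..Suc n} \<and> v i \<ge> p i) = Suc n" if "v (Suc n) \<ge> p (Suc n)"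
      using that by (intro Least_equality) (auto simp: le_Suc_eq)
    moreover have "(\<exists>i\<in>{1..Suc n}. v i \<ge> p i) \<longleftrightarrow> v (Suc n) \<ge> p (Suc n)"
      using False by (simp add: atLeastAtMostSuc_conv)
    ultimately show ?thesis
      using False by (simp only: sale_price.simps Suc.IH if_False) simp
  qed
qed simp

lemma revenue_eq_sale_price: "revenue n p v = sale_price n p 0 v"
  unfolding revenue_def sale_price_eq ..

text \<open>The accumulator matters only if nobody buys; otherwise both sides are the same price, as
  the weights sum to 1. This lets an average over the last buyer's valuation be moved into the
  accumulator.\<close>

lemma sale_price_affine:
  "sale_price n p (a * r + (1 - a) * s) v = a * sale_price n p r v + (1 - a) * sale_price n p s v"
  unfolding sale_price_eq by (simp add: algebra_simps)

lemma sale_price_fun_upd: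
  "n < m \<Longrightarrow> sale_price n p r (v(m := y)) = sale_price n p r v"
  by (induction n arbitrary: r) auto

text \<open>The outcome is either \<open>r\<close> or one of the prices. The bound is crude but
  holds for arbitrary real prices and gives integrability.\<close>

lemma abs_sale_price_le: "\<bar>sale_price n p r v\<bar> \<le> \<bar>r\<bar> + (\<Sum>i\<in>{1..n}. \<bar>p i\<bar>)"
proof (induction n arbitrary: r)
  case (Suc n)
  show ?case
    using Suc.IH[of "if v (Suc n) \<ge> p (Suc n) then p (Suc n) else r"] by (auto split: if_splits)
qed simp

text \<open>The accumulator is a function \<open>f\<close> of the valuations because one unfolding
  of the recursion already makes it depend on them.\<close>

lemma measurable_sale_price:
  assumes "\<And>i. i \<in> {1..n} \<Longrightarrow> sets (V i) = sets borel" "{1..n} \<subseteq> I"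
    and "f \<in> borel_measurable (PiM I V)"
  shows "(\<lambda>v. sale_price n p (f v) v) \<in> borel_measurable (PiM I V)"
  using assms
proof (induction n arbitrary: f)
  case (Suc n)
  have "(\<lambda>v. v (Suc n)) \<in> borel_measurable (PiM I V)"
    using measurable_component_singleton[of "Suc n" I V] Suc.prems(1)[of "Suc n"] Suc.prems(2)
    by (simp add: subset_iff cong: measurable_cong_sets)
  then have "(\<lambda>v. if v (Suc n) \<ge> p (Suc n) then p (Suc n) else f v) \<in> borel_measurable (PiM I V)"
    using Suc.prems(3) by measurable
  then show ?case
    unfolding sale_price.simps by (rule Suc.IH[rotated 2]) (use Suc.prems in auto)
qed simp

text \<open>The backward revenue recursion for fixed prices \<open>p\<close> and arbitrary
  acceptance probabilities \<open>q\<close>; \<open>r\<close> is the value collected once buyers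
  \<open>1\<close>, ..., \<open>i\<close> have all declined.\<close>

fun chain_value :: "(nat \<Rightarrow> real \<Rightarrow> real) \<Rightarrow> nat \<Rightarrow> real \<Rightarrow> (nat \<Rightarrow> real) \<Rightarrow> real" where
  "chain_value q 0 r p = r"
| "chain_value q (Suc i) r p = chain_value q i
     (p (Suc i) * q (Suc i) (p (Suc i)) + (1 - q (Suc i) (p (Suc i))) * r) p"

text \<open>Fubini, integrating out the last buyer first: that valuation affects only the
  accumulator, whose average is the next value of the recursion. The accumulator stays general for
  the induction.\<close>

lemma integral_sale_price:
  assumes "\<And>i. real_distribution (V i)"
  shows "(\<integral>v. sale_price n p r v \<partial>PiM {1..n} V) =
    chain_value (\<lambda>i x. measure (V i) {x..}) n r p"
proof (induction n arbitrary: r)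
  case 0
  then show ?case by (simp add: PiM_empty lebesgue_integral_count_space_finite)
next
  case (Suc n)
  interpret D: real_distribution "V i" for i by (rule assms)
  interpret product_prob_space V ..
  interpret product_sigma_finite V ..
  let ?x = "p (Suc n)"
  define q where "q = measure (V (Suc n)) {?x..}"
  have "measure (V (Suc n)) UNIV = 1"
    using D.prob_space[of "Suc n"] by simp
  note [simp] = this
  have set_eq: "{1..Suc n} = insert (Suc n) {1..n}" by auto
  have int: "integrable (PiM (insert (Suc n) {1..n}) V) (sale_price (Suc n) p r)"
  proof (rule finite_measure.integrable_const_bound)
    show "finite_measure (PiM (insert (Suc n) {1..n}) V)"
      by (rule prob_space.finite_measure) (intro prob_space_PiM D.prob_space_axioms)
    show "AE v in PiM (insert (Suc n) {1..n}) V.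
        norm (sale_price (Suc n) p r v) \<le> \<bar>r\<bar> + (\<Sum>i\<in>{1..Suc n}. \<bar>p i\<bar>)"
      using abs_sale_price_le by (intro AE_I2) (simp only: real_norm_def)
    show "sale_price (Suc n) p r \<in> borel_measurable (PiM (insert (Suc n) {1..n}) V)"
      by (rule measurable_sale_price) auto
  qed
  have inner: "(\<integral>y. sale_price (Suc n) p r (v(Suc n := y)) \<partial>V (Suc n)) =
      sale_price n p (?x * q + (1 - q) * r) v" for v
  proof -
    \<comment> \<open>Coordinate \<open>Suc n\<close> only selects the accumulator, so in
      \<open>y\<close> the integrand is a constant plus a multiple of an indicator.\<close>
    have "(\<integral>y. sale_price (Suc n) p r (v(Suc n := y)) \<partial>V (Suc n)) =
        (\<integral>y. sale_price n p r v + (sale_price n p ?x v - sale_price n p r v) *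
          indicator {?x..} y \<partial>V (Suc n))"
      by (intro Bochner_Integration.integral_cong refl)
         (auto simp: sale_price_fun_upd indicator_def)
    also have "\<dots> = sale_price n p r v + (sale_price n p ?x v - sale_price n p r v) * q"
      by (subst Bochner_Integration.integral_add)
         (auto simp: D.prob_space q_def D.emeasure_eq_measure)
    also have "\<dots> = sale_price n p (q * ?x + (1 - q) * r) v"
      unfolding sale_price_affine by (simp add: algebra_simps)
    finally show ?thesis by (simp add: mult.commute)
  qed
  have "(\<integral>v. sale_price (Suc n) p r v \<partial>PiM {1..Suc n} V) =
      (\<integral>v. (\<integral>y. sale_price (Suc n) p r (v(Suc n := y)) \<partial>V (Suc n)) \<partial>PiM {1..n} V)"
    unfolding set_eq by (rule product_integral_insert[OF _ _ int]) auto
  also have "\<dots> = chain_value (\<lambda>i x. measure (V i) {x..}) n (?x * q + (1 - q) * r) p"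
    unfolding inner by (rule Suc.IH)
  finally show ?case by (simp add: q_def)
qed

lemma chain_value_cong:
  "(\<And>i. i \<in> {1..n} \<Longrightarrow> q i = q' i \<and> p i = p' i) \<Longrightarrow> chain_value q n r p = chain_value q' n r p'"
  by (induction n arbitrary: r) auto

lemma valuation_distributionD:
  assumes "valuation_distribution D"
  shows "prob_space D" "sets D = sets borel"
  using assms
  by (auto simp: valuation_distribution_def real_distribution_def real_distribution_axioms_def)

lemma Rev_eq_chain_value:
  assumes V: "\<And>i. i \<in> {1..n} \<Longrightarrow> valuation_distribution (V i)"
  shows "Rev n V p = chain_value (\<lambda>i x. measure (V i) {x..}) n 0 p"
proof -
  \<comment> \<open>The product measure theory wants probability measures at all indices.\<close>
  define V' where "V' i = (if i \<in> {1..n} then V i else return borel 0)" for i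
  have V': "real_distribution (V' i)" for i
    using valuation_distributionD[OF V] prob_space_return[of "0::real" borel]
    by (auto simp: V'_def real_distribution_def real_distribution_axioms_def)
  have "Rev n V p = (\<integral>v. sale_price n p 0 v \<partial>PiM {1..n} V')"
    unfolding Rev_def revenue_eq_sale_price
    by (rule arg_cong[where f = "\<lambda>M. integral\<^sup>L M _"]) (auto intro: PiM_cong simp: V'_def)
  also have "\<dots> = chain_value (\<lambda>i x. measure (V' i) {x..}) n 0 p"
    using V' by (rule integral_sale_price)
  also have "\<dots> = chain_value (\<lambda>i x. measure (V i) {x..}) n 0 p"
    by (rule chain_value_cong) (simp add: V'_def)
  finally show ?thesis .
qed

section \<open>Error propagation in the price loop\<close>

text \<open>The remaining rounds write only to positions up to \<open>i\<close>, so a price survives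
  to the output once it is fixed.\<close>

lemma loop_output_prices_above:
  "loop_output K b \<omega> i p r p' r' \<Longrightarrow> k > i \<Longrightarrow> p' k = p k"
  by (induction rule: loop_output.induct) auto

lemma price_grid_subset: "price_grid b \<subseteq> {0..1}"
  by (auto simp: price_grid_def divide_le_eq_1)

text \<open>Here \<open>s\<close> follows the true recursion along the prices that the algorithm
  chose, while \<open>r\<close> follows the empirical one. A round passes on at most the old gap and
  adds at most \<delta>, because prices and continuation values lie in the unit interval.\<close>

lemma loop_output_approx:
  assumes "loop_output K b \<omega> i p r p' r'"
    and "\<And>k x. k \<in> {1..i} \<Longrightarrow> x \<in> price_grid b \<Longrightarrow>
      \<bar>measure_pmf.prob (empirical K \<omega> k) {v. v \<ge> x} - q k x\<bar> \<le> \<delta>"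
    and "\<And>k x. k \<in> {1..i} \<Longrightarrow> q k x \<in> {0..1}"
    and "r \<in> {0..1}"
  shows "\<bar>r' - chain_value q i s p'\<bar> \<le> \<bar>r - s\<bar> + real i * \<delta>"
  using assms
proof (induction arbitrary: s rule: loop_output.induct)
  case (2 i r x p p' r')
  then obtain j where j: "i = Suc j" by (cases i) auto
  let ?P = "measure_pmf.prob (empirical K \<omega> i) {v. v \<ge> x}"
  have x: "x \<in> price_grid b" using 2(1) by (simp add: is_arg_max_def)
  then have x01: "x \<in> {0..1}" using price_grid_subset by blast
  have "p' i = x" using loop_output_prices_above[OF 2(2), of i] 2(3) by simp
  let ?s = "x * q i x + (1 - q i x) * s"
  have d: "\<bar>?P - q i x\<bar> \<le> \<delta>" and q: "q i x \<in> {0..1}" using 2 x by auto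
  \<comment> \<open>The gap splits into the error in the acceptance probability, weighted by
    \<open>x - r\<close>, and the old gap, weighted by the probability of declining.\<close>
  have "empirical_value K \<omega> i r x - ?s = (?P - q i x) * (x - r) + (1 - q i x) * (r - s)"
    by (simp add: empirical_value_def algebra_simps)
  also have "\<bar>\<dots>\<bar> \<le> \<bar>?P - q i x\<bar> * \<bar>x - r\<bar> + (1 - q i x) * \<bar>r - s\<bar>"
    using q by (intro order.trans[OF abs_triangle_ineq]) (simp add: abs_mult)
  also have "\<dots> \<le> \<delta> * 1 + 1 * \<bar>r - s\<bar>"
    using d q x01 \<open>r \<in> {0..1}\<close> by (intro add_mono mult_mono) (auto simp: abs_le_iff)
  finally have 1: "\<bar>empirical_value K \<omega> i r x - ?s\<bar> \<le> \<delta> + \<bar>r - s\<bar>" by simp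
  \<comment> \<open>A convex combination of \<open>x\<close> and \<open>r\<close>, so the invariant
    \<open>r \<in> {0..1}\<close> is kept.\<close>
  have "empirical_value K \<omega> i r x \<in> {0..1}"
    using x01 \<open>r \<in> {0..1}\<close> convex_bound_le[of x 1 r ?P "1 - ?P"]
    by (simp add: empirical_value_def mult.commute)
  then have "\<bar>r' - chain_value q (i - 1) ?s p'\<bar> \<le> \<bar>empirical_value K \<omega> i r x - ?s\<bar> + real (i - 1) * \<delta>"
    by (intro 2(4)) (use 2(5,6) in auto)
  then show ?case
    using 1 \<open>p' i = x\<close> by (simp add: j algebra_simps)
qed simp

text \<open>A one-sided invariant suffices: the true value \<open>s\<close> of the competitor
  \<open>p\<^sub>0\<close> exceeds the empirical \<open>r\<close> by at most \<open>e\<close>. Since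
  \<open>e\<close> already dominates \<open>1 / b\<close>, rounding is not charged again, and
  \<open>e\<close> grows only by \<delta> per round.\<close>

lemma loop_output_near_optimal:
  assumes "loop_output K b \<omega> i p r p' r'"
    and "\<And>k x. k \<in> {1..i} \<Longrightarrow> x \<in> price_grid b \<Longrightarrow>
      \<bar>measure_pmf.prob (empirical K \<omega> k) {v. v \<ge> x} - q k x\<bar> \<le> \<delta>"
    and "\<And>k x. k \<in> {1..i} \<Longrightarrow> q k x \<in> {0..1}"
    and "\<And>k x y. k \<in> {1..i} \<Longrightarrow> x \<le> y \<Longrightarrow> q k y \<le> q k x"
    and "\<And>k. k \<in> {1..i} \<Longrightarrow> p\<^sub>0 k \<in> {0..1}"
    and "r \<in> {0..1}" "b > 0" "1 / real b \<le> e" "s \<le> r + e" "\<delta> \<ge> 0"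
  shows "chain_value q i s p\<^sub>0 \<le> r' + e + real i * \<delta>"
  using assms
proof (induction arbitrary: s e rule: loop_output.induct)
  case (2 i r x p p' r')
  then obtain j where j: "i = Suc j" by (cases i) auto
  let ?P = "\<lambda>x. measure_pmf.prob (empirical K \<omega> i) {v. v \<ge> x}" and ?y = "p\<^sub>0 i"
  \<comment> \<open>The competitor's price rounded down to the grid: it loses at most
    \<open>1 / b\<close>, and the acceptance probability cannot drop.\<close>
  define z where "z = real (nat \<lfloor>b * ?y\<rfloor>) / b"
  have y01: "?y \<in> {0..1}" and q: "q i ?y \<in> {0..1}" using 2 by auto
  have z: "z \<in> price_grid b"
  proof -
    have "b * ?y \<le> b" using y01 by (simp add: mult_left_le)
    then have "nat \<lfloor>b * ?y\<rfloor> \<le> b" by linarith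
    then show ?thesis by (auto simp: price_grid_def z_def)
  qed
  then have z01: "z \<in> {0..1}" using price_grid_subset by blast
  have "real (nat \<lfloor>b * ?y\<rfloor>) \<le> b * ?y" "b * ?y \<le> real (nat \<lfloor>b * ?y\<rfloor>) + 1"
    using y01 by (auto simp: of_nat_nat)
  then have zy: "z \<le> ?y" "?y \<le> z + e"
    using \<open>b > 0\<close> \<open>1 / real b \<le> e\<close> by (auto simp: z_def field_simps)
  have "e \<ge> 0" using \<open>b > 0\<close> \<open>1 / real b \<le> e\<close> by (smt (verit) divide_nonneg_nonneg of_nat_0_le_iff)
  have x: "x \<in> price_grid b" using 2(1) by (simp add: is_arg_max_def)
  then have x01: "x \<in> {0..1}" using price_grid_subset by blast
  have opt: "empirical_value K \<omega> i r x' \<le> empirical_value K \<omega> i r x" if "x' \<in> price_grid b" for x'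
    using 2(1) that by (simp add: is_arg_max_linorder)
  \<comment> \<open>Price 1 yields at least \<open>r\<close>, since \<open>r \<le> 1\<close>; hence
    no round lowers the empirical value.\<close>
  have "1 \<in> price_grid b"
    using \<open>b > 0\<close> by (force simp: price_grid_def intro: exI[of _ b])
  from opt[OF this] have ge_r: "empirical_value K \<omega> i r x \<ge> r"
    using \<open>r \<in> {0..1}\<close> mult_left_mono[of r 1 "?P 1"] by (simp add: empirical_value_def algebra_simps)
  let ?s = "?y * q i ?y + (1 - q i ?y) * s"
  \<comment> \<open>A sale loses at most \<open>e\<close> by rounding, a refusal at most
    \<open>e\<close> by the invariant; the weights sum to 1, so the total loss is a single
    \<open>e\<close>.\<close>
  have "?s \<le> (z + e) * q i ?y + (1 - q i ?y) * (r + e)"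
    using zy q \<open>s \<le> r + e\<close> by (intro add_mono mult_mono mult_left_mono mult_right_mono) auto
  also have "\<dots> = r + q i ?y * (z - r) + e" by (simp add: algebra_simps)
  also have "\<dots> \<le> empirical_value K \<omega> i r x + \<delta> + e"
  \<comment> \<open>If \<open>z \<le> r\<close>, a sale at \<open>z\<close> gains nothing over
    continuing, and \<open>ge_r\<close> suffices. Otherwise the gain \<open>z - r\<close> is
    positive, so a larger acceptance probability only helps, and \<open>z\<close> itself competes in
    the \<open>arg max\<close>.\<close>
  proof (cases "z \<le> r")
    case True
    then have "q i ?y * (z - r) \<le> 0" using q by (simp add: mult_nonneg_nonpos)
    then show ?thesis using ge_r \<open>\<delta> \<ge> 0\<close> by linarith
  next
    case False
    have "q i ?y \<le> q i z" using 2 zy by auto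
    also have "\<dots> \<le> ?P z + \<delta>" using 2(5)[of i z] z \<open>i > 0\<close> by (simp add: abs_le_iff)
    finally have "q i ?y * (z - r) \<le> (?P z + \<delta>) * (z - r)"
      using False by (intro mult_right_mono) auto
    also have "\<dots> \<le> ?P z * (z - r) + \<delta>"
      using \<open>\<delta> \<ge> 0\<close> z01 \<open>r \<in> {0..1}\<close> mult_left_mono[of "z - r" 1 \<delta>] by (simp add: algebra_simps)
    finally have "r + q i ?y * (z - r) \<le> empirical_value K \<omega> i r z + \<delta>"
      by (simp add: empirical_value_def algebra_simps)
    then show ?thesis using opt[OF z] by linarith
  qed
  finally have "?s \<le> empirical_value K \<omega> i r x + (e + \<delta>)" by simp
  moreover have "empirical_value K \<omega> i r x \<in> {0..1}"
    using x01 \<open>r \<in> {0..1}\<close> convex_bound_le[of x 1 r "?P x" "1 - ?P x"]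
    by (simp add: empirical_value_def mult.commute)
  \<comment> \<open>The induction hypothesis is applied with slack \<open>e + \<delta>\<close>,
    which still dominates \<open>1 / b\<close>.\<close>
  ultimately have "chain_value q (i - 1) ?s p\<^sub>0 \<le> r' + (e + \<delta>) + real (i - 1) * \<delta>"
    by (intro 2(4)) (use 2(5-) in auto)
  then show ?case by (simp add: j algebra_simps)
qed simp

section \<open>Concentration of the samples\<close>

text \<open>On the product space, restriction to \<open>I\<close> is the identity, so the joint
  distribution of the coordinates is the product of their marginals. This characterizes independence
  for nonempty \<open>I\<close>; the empty family is immediate.\<close>

lemma indep_vars_PiM_coordinates:
  assumes "\<And>i. i \<in> I \<Longrightarrow> prob_space (M i)"
  shows "prob_space.indep_vars (PiM I M) M (\<lambda>i \<omega>. \<omega> i) I"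
proof -
  interpret prob_space "PiM I M" using assms by (rule prob_space_PiM)
  show ?thesis
  proof (cases "I = {}")
    case True
    then show ?thesis unfolding indep_vars_def indep_sets_def by auto
  next
    case False
    have "distr (PiM I M) (PiM I M) (\<lambda>\<omega>. \<lambda>i\<in>I. \<omega> i) = distr (PiM I M) (PiM I M) (\<lambda>\<omega>. \<omega>)"
      by (rule distr_cong) (auto simp: space_PiM)
    also have "\<dots> = (\<Pi>\<^sub>M i\<in>I. distr (PiM I M) (M i) (\<lambda>\<omega>. \<omega> i))"
      using assms by (simp add: distr_PiM_component cong: PiM_cong)
    finally show ?thesis
      using False by (subst indep_vars_iff_distr_eq_PiM') auto
  qed
qed

lemma prob_empirical:
  assumes "K > 0"
  shows "measure_pmf.prob (empirical K \<omega> i) {v. v \<ge> x} = (\<Sum>k<K. indicator {x..} (\<omega> (i, k))) / K"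
proof -
  have "{..<K} \<inter> (\<lambda>k. \<omega> (i, k)) -` {v. v \<ge> x} = {k. k < K \<and> x \<le> \<omega> (i, k)}"
    by auto
  moreover have "{..<K} \<inter> {k. x \<le> \<omega> (i, k)} = {k. k < K \<and> x \<le> \<omega> (i, k)}"
    by auto
  ultimately show ?thesis
    using assms
    by (simp add: empirical_def measure_pmf_of_set lessThan_empty_iff indicator_def sum.If_cases)
qed

text \<open>Hoeffding's inequality for the \<open>K\<close> acceptance indicators of buyer
  \<open>i\<close>, each with values in the unit interval. A deviation \<delta> of the mean is a
  deviation \<open>K * \<delta>\<close> of the sum, and the squared ranges add up to
  \<open>K\<close>.\<close>

lemma prob_empirical_deviation:
  assumes V: "\<And>i. i \<in> {1..n} \<Longrightarrow> valuation_distribution (V i)"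
    and i: "i \<in> {1..n}" and "K > 0" "\<delta> \<ge> 0"
  shows "measure (sample_space n K V) {\<omega> \<in> space (sample_space n K V).
      \<bar>measure_pmf.prob (empirical K \<omega> i) {v. v \<ge> x} - measure (V i) {x..}\<bar> \<ge> \<delta>}
    \<le> 2 * exp (- 2 * real K * \<delta>\<^sup>2)"
proof -
  let ?I = "{1..n} \<times> {..<K}" and ?V = "\<lambda>(i, k). V i" and ?S = "{i} \<times> {..<K}"
  let ?q = "measure (V i) {x..}"
  let ?X = "\<lambda>s \<omega>. indicat_real {x..} (\<omega> s)"
  have D: "prob_space (?V s)" "sets (?V s) = sets borel" if "s \<in> ?I" for s
    using valuation_distributionD[OF V] that by (auto split: prod.splits)
  have ind: "indicat_real {x..} \<in> borel_measurable (?V s)" if "s \<in> ?I" for s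
    unfolding measurable_cong_sets[OF D(2)[OF that] refl] by measurable
  have SI: "?S \<subseteq> ?I" using i by auto
  interpret prob_space "PiM ?I ?V" using D(1) by (rule prob_space_PiM)
  have E: "expectation (?X s) = ?q" if "s \<in> ?S" for s
  proof -
    have s: "s \<in> ?I" "?V s = V i" using that SI by auto
    have "expectation (?X s) = (\<integral>y. indicator {x..} y \<partial>distr (PiM ?I ?V) (?V s) (\<lambda>\<omega>. \<omega> s))"
      using s(1) by (intro integral_distr [symmetric] ind) auto
    also have "\<dots> = (\<integral>y. indicator {x..} y \<partial>V i)"
      using distr_PiM_component[of ?I ?V s, OF D(1) s(1)] by (simp only: s(2))
    also have "\<dots> = ?q"
      using D[OF s(1)] s by (simp add: sets_eq_imp_space_eq[of "V i" borel])
    finally show ?thesis .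
  qed
  interpret Hoeffding_ineq "PiM ?I ?V" ?S ?X "\<lambda>_. 0" "\<lambda>_. 1" "\<Sum>s\<in>?S. expectation (?X s)"
  proof unfold_locales
    show "indep_vars (\<lambda>_. borel) ?X ?S"
      by (rule indep_vars_compose2[OF indep_vars_subset[OF indep_vars_PiM_coordinates SI]])
         (use D(1) SI ind in \<open>blast+\<close>)
  qed auto
  have sum: "(\<Sum>s\<in>?S. ?X s \<omega>) = (\<Sum>k<K. indicator {x..} (\<omega> (i, k)))" for \<omega>
    by (simp add: sum.cartesian_product')
  have mu: "(\<Sum>s\<in>?S. expectation (?X s)) = real K * ?q"
    using E by (simp add: sum.cong)
  have "prob {\<omega> \<in> space (PiM ?I ?V). \<bar>(\<Sum>s\<in>?S. ?X s \<omega>) - (\<Sum>s\<in>?S. expectation (?X s))\<bar> \<ge> real K * \<delta>}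
      \<le> 2 * exp (- 2 * (real K * \<delta>)\<^sup>2 / (\<Sum>s\<in>?S. (1 - 0)\<^sup>2))"
    by (rule Hoeffding_ineq_abs_ge) (use \<open>K > 0\<close> \<open>\<delta> \<ge> 0\<close> in auto)
  also have "{\<omega> \<in> space (PiM ?I ?V). \<bar>(\<Sum>s\<in>?S. ?X s \<omega>) - (\<Sum>s\<in>?S. expectation (?X s))\<bar> \<ge> real K * \<delta>} =
      {\<omega> \<in> space (PiM ?I ?V). \<bar>measure_pmf.prob (empirical K \<omega> i) {v. v \<ge> x} - ?q\<bar> \<ge> \<delta>}"
  proof (intro Collect_cong conj_cong refl)
    fix \<omega>
    have "(\<Sum>s\<in>?S. ?X s \<omega>) - (\<Sum>s\<in>?S. expectation (?X s)) =
        real K * (measure_pmf.prob (empirical K \<omega> i) {v. v \<ge> x} - ?q)"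
      unfolding sum mu prob_empirical[OF \<open>K > 0\<close>] using \<open>K > 0\<close> by (simp add: field_simps)
    then show "\<bar>(\<Sum>s\<in>?S. ?X s \<omega>) - (\<Sum>s\<in>?S. expectation (?X s))\<bar> \<ge> real K * \<delta> \<longleftrightarrow>
        \<bar>measure_pmf.prob (empirical K \<omega> i) {v. v \<ge> x} - ?q\<bar> \<ge> \<delta>"
      using \<open>K > 0\<close> by (simp only: abs_mult) simp
  qed
  also have "- 2 * (real K * \<delta>)\<^sup>2 / (\<Sum>s\<in>?S. (1 - 0)\<^sup>2) = - 2 * real K * \<delta>\<^sup>2"
    using \<open>K > 0\<close> by (simp add: power2_eq_square)
  finally show ?thesis by (simp add: sample_space_def)
qed

section \<open>Measurability of the success event\<close>

text \<open>Only grid prices are ever evaluated, so the possible outputs depend on the samples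
  through the acceptance frequencies at these prices alone.\<close>

lemma loop_output_cong:
  assumes "loop_output K b \<omega> i p r p' r'"
    and "\<And>k x. k \<in> {1..i} \<Longrightarrow> x \<in> price_grid b \<Longrightarrow>
      measure_pmf.prob (empirical K \<omega> k) {v. v \<ge> x} = measure_pmf.prob (empirical K \<omega>' k) {v. v \<ge> x}"
  shows "loop_output K b \<omega>' i p r p' r'"
  using assms
proof (induction rule: loop_output.induct)
  case (2 i r x p p' r')
  have eq: "empirical_value K \<omega>' i r y = empirical_value K \<omega> i r y" if "y \<in> price_grid b" for y
    using 2(3) 2(5)[of i y] that by (simp add: empirical_value_def)
  show ?case
  proof (rule loop_output.intros(2))
    show max: "is_arg_max (empirical_value K \<omega>' i r) (\<lambda>x. x \<in> price_grid b) x"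
      using 2(1) eq by (simp add: is_arg_max_linorder)
    show "loop_output K b \<omega>' (i - 1) (p(i := x)) (empirical_value K \<omega>' i r x) p' r'"
      unfolding eq[OF max[unfolded is_arg_max_def, THEN conjunct1]]
      by (rule 2(4)) (use 2(5) in auto)
  qed fact
qed (rule loop_output.intros(1))

text \<open>The samples enter only through comparisons with grid prices, so they may be rounded down to
  multiples of \<open>1/b\<close>; the event below thus lives on a countable space.\<close>

lemma sets_find_apx_prices_event:
  assumes V: "\<And>i. i \<in> {1..n} \<Longrightarrow> sets (V i) = sets borel" and "K > 0" "b > 0"
  shows "{\<omega> \<in> space (sample_space n K V).
      \<forall>\<sigma> p r. result (find_apx_prices \<sigma> \<omega> n K b) = (p, r) \<longrightarrow> \<Phi> p r} \<in> sets (sample_space n K V)"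
proof -
  let ?I = "{1..n} \<times> {..<K}" and ?V = "\<lambda>(i, k). V i"
  define T where "T \<omega> = (\<lambda>s\<in>?I. \<lfloor>real b * \<omega> s\<rfloor>)" for \<omega> :: "nat \<times> nat \<Rightarrow> real"
  define U where "U z s = real_of_int (z s) / real b" for z :: "nat \<times> nat \<Rightarrow> int" and s
  define A where "A = {z \<in> ?I \<rightarrow>\<^sub>E UNIV. \<forall>p r. loop_output K b (U z) n (\<lambda>_. 0) 0 p r \<longrightarrow> \<Phi> p r}"
  have sets: "sets (?V s) = sets borel" if "s \<in> ?I" for s
    using V that by auto
  have "T \<in> measurable (PiM ?I ?V) (PiM ?I (\<lambda>_. count_space UNIV))"
    unfolding T_def
  proof (rule measurable_restrict)
    fix s assume s: "s \<in> ?I"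
    have "(\<lambda>y. \<lfloor>real b * y\<rfloor>) \<in> measurable borel (count_space UNIV)" by measurable
    then have "(\<lambda>y. \<lfloor>real b * y\<rfloor>) \<in> measurable (?V s) (count_space UNIV)"
      using sets[OF s] by (simp cong: measurable_cong_sets)
    then show "(\<lambda>\<omega>. \<lfloor>real b * \<omega> s\<rfloor>) \<in> measurable (PiM ?I ?V) (count_space UNIV)"
      using s by (rule measurable_PiM_component_rev[rotated])
  qed
  \<comment> \<open>The target is discrete, as \<open>?I\<close> is finite and \<open>int\<close>
    countable; hence \<open>A\<close> is measurable whatever \<open>\<Phi>\<close> is.\<close>
  also have "PiM ?I (\<lambda>_. count_space UNIV) = count_space (?I \<rightarrow>\<^sub>E (UNIV :: int set))"
    by (rule count_space_PiM_finite) auto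
  finally have "T -` A \<inter> space (PiM ?I ?V) \<in> sets (PiM ?I ?V)"
    by (rule measurable_sets) (auto simp: A_def)
  also have "T -` A \<inter> space (PiM ?I ?V) = {\<omega> \<in> space (PiM ?I ?V).
      \<forall>\<sigma> p r. result (find_apx_prices \<sigma> \<omega> n K b) = (p, r) \<longrightarrow> \<Phi> p r}"
  proof -
    \<comment> \<open>An integer \<open>j\<close> lies below a real exactly if it lies below its
      floor, so rounding preserves every comparison with a grid price.\<close>
    have ge: "j / b \<le> U (T \<omega>) (i, k) \<longleftrightarrow> j / b \<le> \<omega> (i, k)" if "i \<in> {1..n}" "k < K" for i k \<omega>
      and j :: nat
    proof -
      have "real j \<le> \<lfloor>real b * \<omega> (i, k)\<rfloor> \<longleftrightarrow> real j \<le> real b * \<omega> (i, k)"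
        using le_floor_iff[of "int j" "real b * \<omega> (i, k)"] by linarith
      then show ?thesis
        using \<open>b > 0\<close> that by (simp add: U_def T_def field_simps)
    qed
    have "measure_pmf.prob (empirical K (U (T \<omega>)) i) {v. v \<ge> x} =
        measure_pmf.prob (empirical K \<omega> i) {v. v \<ge> x}" if "i \<in> {1..n}" "x \<in> price_grid b" for \<omega> i x
      unfolding prob_empirical[OF \<open>K > 0\<close>]
      by (intro arg_cong2[where f = "(/)"] sum.cong refl) (use ge that in \<open>auto simp: price_grid_def indicator_def\<close>)
    then have "loop_output K b (U (T \<omega>)) n (\<lambda>_. 0) 0 p r \<longleftrightarrow> loop_output K b \<omega> n (\<lambda>_. 0) 0 p r" for \<omega> p r
      by (metis loop_output_cong)
    then show ?thesis
      unfolding A_def T_def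
      using find_apx_prices_iff[OF assms(2,3)] by (auto simp: T_def) blast+
  qed
  finally show ?thesis by (simp add: sample_space_def)
qed

section \<open>From accurate frequencies to the success probability\<close>

lemma card_price_grid_le: "finite (price_grid b)" "card (price_grid b) \<le> b + 1"
proof -
  have eq: "price_grid b = (\<lambda>j. real j / real b) ` {..b}"
    by (auto simp: price_grid_def)
  show "finite (price_grid b)" "card (price_grid b) \<le> b + 1"
    unfolding eq using card_image_le[of "{..b}" "\<lambda>j. real j / real b"] by auto
qed

text \<open>The deterministic half. The optimum exceeds \<open>r\<close> by at most
  \<open>1 / b + n * \<delta>\<close>, and \<open>r\<close> differs from the true revenue of
  \<open>p\<close> by at most \<open>n * \<delta>\<close>; together these give the bound assumed on
  \<epsilon>.\<close>

lemma find_apx_prices_approx: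
  assumes V: "\<And>i. i \<in> {1..n} \<Longrightarrow> valuation_distribution (V i)"
    and "K > 0" "b > 0" "\<delta> \<ge> 0" and \<epsilon>: "1 / real b + 2 * real n * \<delta> \<le> \<epsilon>"
    and dev: "\<And>i x. i \<in> {1..n} \<Longrightarrow> x \<in> price_grid b \<Longrightarrow>
      \<bar>measure_pmf.prob (empirical K \<omega> i) {v. v \<ge> x} - measure (V i) {x..}\<bar> \<le> \<delta>"
    and res: "result (find_apx_prices \<sigma> \<omega> n K b) = (p, r)"
  shows "Rev n V p \<ge> (SUP p'\<in>price_vectors n. Rev n V p') - \<epsilon>"
    and "r \<in> {Rev n V p - \<epsilon> .. Rev n V p + \<epsilon>}"
proof -
  define q where "q i x = measure (V i) {x..}" for i x
  have Rev: "Rev n V p' = chain_value q n 0 p'" for p'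
    unfolding q_def using V by (rule Rev_eq_chain_value)
  note D = valuation_distributionD[OF V]
  have q01: "q i x \<in> {0..1}" if "i \<in> {1..n}" for i x
    using prob_space.prob_le_1[OF D(1)[OF that]] by (simp add: q_def)
  have anti: "q i y \<le> q i x" if "i \<in> {1..n}" "x \<le> y" for i x y
    unfolding q_def
    by (rule finite_measure.finite_measure_mono[OF prob_space.finite_measure[OF D(1)[OF that(1)]]])
       (use that D(2) in auto)
  have out: "loop_output K b \<omega> n (\<lambda>_. 0) 0 p r"
    using res find_apx_prices_iff[OF \<open>K > 0\<close> \<open>b > 0\<close>] by blast
  have close: "\<bar>r - Rev n V p\<bar> \<le> real n * \<delta>"
    using loop_output_approx[OF out, of q \<delta> 0] dev q01 by (simp add: Rev q_def)
  moreover have "real n * \<delta> \<ge> 0" "1 / real b \<ge> 0" using \<open>\<delta> \<ge> 0\<close> by auto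
  ultimately show "r \<in> {Rev n V p - \<epsilon> .. Rev n V p + \<epsilon>}"
    using \<epsilon> unfolding atLeastAtMost_iff abs_le_iff by linarith
  have "Rev n V p' \<le> Rev n V p + \<epsilon>" if "p' \<in> price_vectors n" for p'
  proof -
    have "chain_value q n 0 p' \<le> r + 1 / real b + real n * \<delta>"
      by (rule loop_output_near_optimal[OF out, of q \<delta> p'])
         (use dev q01 anti that \<open>b > 0\<close> \<open>\<delta> \<ge> 0\<close> in \<open>auto simp: q_def price_vectors_def PiE_iff\<close>)
    then show ?thesis using close \<epsilon> by (simp add: Rev abs_le_iff)
  qed
  moreover have "price_vectors n \<noteq> {}"
    by (simp add: price_vectors_def PiE_eq_empty_iff)
  ultimately show "Rev n V p \<ge> (SUP p'\<in>price_vectors n. Rev n V p') - \<epsilon>"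
    using cSUP_least[of "price_vectors n" "Rev n V" "Rev n V p + \<epsilon>"] by simp
qed

text \<open>Union bound: a failure forces a deviation of at least \<delta> at one of at most
  \<open>n * (b + 1)\<close> pairs of buyer and grid price. The deviations do not involve
  \<open>\<sigma>\<close>, so one good event serves all tie rules at once.\<close>

lemma find_apx_prices_prob:
  assumes V: "\<And>i. i \<in> {1..n} \<Longrightarrow> valuation_distribution (V i)"
    and "K > 0" "b > 0" "\<delta> \<ge> 0" and \<epsilon>: "1 / real b + 2 * real n * \<delta> \<le> \<epsilon>"
  shows "\<P>(\<omega> in sample_space n K V. \<forall>\<sigma> p r. result (find_apx_prices \<sigma> \<omega> n K b) = (p, r) \<longrightarrow>
      Rev n V p \<ge> (SUP p'\<in>price_vectors n. Rev n V p') - \<epsilon> \<and>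
      r \<in> {Rev n V p - \<epsilon> .. Rev n V p + \<epsilon>})
    \<ge> 1 - 2 * real n * (real b + 1) * exp (- 2 * real K * \<delta>\<^sup>2)" (is "measure ?M ?G \<ge> _")
proof -
  define B where "B = (\<lambda>(i, x). {\<omega> \<in> space ?M.
      \<bar>measure_pmf.prob (empirical K \<omega> i) {v. v \<ge> x} - measure (V i) {x..}\<bar> \<ge> \<delta>})"
  let ?J = "{1..n} \<times> price_grid b"
  note D = valuation_distributionD[OF V]
  interpret prob_space ?M
    unfolding sample_space_def by (rule prob_space_PiM) (use D(1) in auto)
  have G: "?G \<in> sets ?M"
    using D(2) \<open>K > 0\<close> \<open>b > 0\<close> by (intro sets_find_apx_prices_event)
  have "space ?M - ?G \<subseteq> (\<Union>s\<in>?J. B s)"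
  proof
    fix \<omega> assume \<omega>: "\<omega> \<in> space ?M - ?G"
    show "\<omega> \<in> (\<Union>s\<in>?J. B s)"
    proof (rule ccontr)
      assume no: "\<omega> \<notin> (\<Union>s\<in>?J. B s)"
      have dev: "\<bar>measure_pmf.prob (empirical K \<omega> i) {v. v \<ge> x} - measure (V i) {x..}\<bar> \<le> \<delta>"
        if "i \<in> {1..n}" "x \<in> price_grid b" for i x
        using no \<omega> that by (force simp: B_def)
      have "\<omega> \<in> ?G"
        using \<omega> find_apx_prices_approx[OF V assms(2-5) dev] by blast
      with \<omega> show False by blast
    qed
  qed
  moreover have B: "B s \<in> sets ?M" if "s \<in> ?J" for s
  proof -
    obtain i x where s: "s = (i, x)" by (cases s)
    with that have i: "i \<in> {1..n}" by auto
    have "(\<lambda>\<omega>. indicat_real {x..} (\<omega> (i, k))) \<in> borel_measurable ?M" if "k < K" for k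
    proof -
      have "indicat_real {x..} \<in> borel_measurable (V i)"
        unfolding measurable_cong_sets[OF D(2)[OF i] refl] by measurable
      then show ?thesis
        unfolding sample_space_def using i that
        by (intro measurable_PiM_component_rev[of "(i, k)"]) auto
    qed
    then have "(\<lambda>\<omega>. \<bar>(\<Sum>k<K. indicat_real {x..} (\<omega> (i, k))) / K - measure (V i) {x..}\<bar>) \<in> borel_measurable ?M"
      by (intro borel_measurable_abs borel_measurable_diff borel_measurable_divide borel_measurable_sum) auto
    then show ?thesis
      unfolding B_def s prod.case prob_empirical[OF \<open>K > 0\<close>] by measurable
  qed
  ultimately have "prob (space ?M - ?G) \<le> prob (\<Union>s\<in>?J. B s)"
    by (intro finite_measure_mono sets.finite_UN) (auto simp: card_price_grid_le)
  also have "\<dots> \<le> (\<Sum>s\<in>?J. prob (B s))"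
    using B by (intro finite_measure_subadditive_finite) (auto simp: card_price_grid_le)
  also have "\<dots> \<le> (\<Sum>s\<in>?J. 2 * exp (- 2 * real K * \<delta>\<^sup>2))"
  proof (rule sum_mono)
    fix s assume "s \<in> ?J"
    then obtain i x where s: "s = (i, x)" and i: "i \<in> {1..n}" by auto
    show "prob (B s) \<le> 2 * exp (- 2 * real K * \<delta>\<^sup>2)"
      unfolding B_def s prod.case
      by (rule prob_empirical_deviation[OF V i \<open>K > 0\<close> \<open>\<delta> \<ge> 0\<close>])
  qed
  also have "\<dots> = real n * real (card (price_grid b)) * (2 * exp (- 2 * real K * \<delta>\<^sup>2))"
    by (simp add: card_cartesian_product)
  also have "\<dots> \<le> real n * real (b + 1) * (2 * exp (- 2 * real K * \<delta>\<^sup>2))"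
    using card_price_grid_le(2)[of b] by (intro mult_right_mono mult_left_mono) (auto simp del: of_nat_add)
  finally show ?thesis
    unfolding prob_compl[OF G] by (simp add: algebra_simps)
qed

section \<open>Running time and polynomial bounds\<close>

lemma steps_draw_samples: "steps (draw_samples \<omega> i k) = 2 * k + 1"
  by (induction k) auto

lemma steps_draw_all: "steps (draw_all \<omega> K n) = n * (2 * K + 2) + 1"
  by (induction n) (auto simp: steps_draw_samples)

lemma steps_count_ge: "steps (count_ge x vs) = 2 * length vs + 1"
  by (induction vs) auto

lemma steps_price_value: "steps (price_value K vs r x) = 2 * length vs + 6"
  by (simp add: price_value_def steps_count_ge)

text \<open>Candidate 0 has no incumbent to be compared with and saves the two comparisons, the tie
  query and the selection; hence the 4 subtracted steps.\<close>

lemma steps_best_price: "steps (best_price \<sigma> K b vs r j) = (j + 1) * (2 * length vs + 11) - 4"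
  by (induction j) (auto simp: steps_price_value case_prod_beta)

lemma steps_price_loop:
  assumes "\<And>k. k \<in> {1..i} \<Longrightarrow> length (S k) = K"
  shows "steps (price_loop \<sigma> K b S i p r) = i * ((b + 1) * (2 * K + 11) + 2 * K + 4) + 1"
  using assms
proof (induction i arbitrary: p r)
  case (Suc i)
  have "length (S (Suc i)) = K" using Suc.prems by simp
  then show ?case
    using Suc by (simp add: steps_price_value steps_best_price case_prod_beta)
qed simp

lemma steps_find_apx_prices:
  "steps (find_apx_prices \<sigma> \<omega> n K b) = n * ((b + 1) * (2 * K + 11) + 4 * K + 6) + 2"
proof -
  have "steps (price_loop \<sigma> K b (result (draw_all \<omega> K n)) n (\<lambda>_. 0) 0) =
      n * ((b + 1) * (2 * K + 11) + 2 * K + 4) + 1"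
    by (rule steps_price_loop) (simp add: result_draw_all result_draw_samples)
  then show ?thesis
    by (simp add: find_apx_prices_def steps_draw_all algebra_simps)
qed

section \<open>Closure properties of polynomials in three variables\<close>

text \<open>Allows any finite index set and repeated exponents, so that closure under sums and
  products reduces to naming a suitable index set.\<close>

lemma polynomial3_sum_monomials:
  assumes "finite S"
  shows "polynomial3 (\<lambda>x y z. \<Sum>s\<in>S. c s * x ^ i s * y ^ j s * z ^ k s)"
proof -
  obtain d where d: "\<forall>s\<in>S. i s \<le> d \<and> j s \<le> d \<and> k s \<le> d"
  proof
    show "\<forall>s\<in>S. i s \<le> (\<Sum>s\<in>S. i s + j s + k s) \<and> j s \<le> (\<Sum>s\<in>S. i s + j s + k s) \<and>
        k s \<le> (\<Sum>s\<in>S. i s + j s + k s)"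
      using member_le_sum[OF _ _ assms, of _ "\<lambda>s. i s + j s + k s"] by fastforce
  qed
  \<comment> \<open>Kronecker deltas send the coefficient of \<open>s\<close> to its exponent
    triple; summing over \<open>S\<close> merges monomials with equal exponents.\<close>
  define t where "t s a b e = (if e = k s then if b = j s then if a = i s then c s else 0 else 0 else 0)"
    for s a b e
  define c' where "c' a b e = (\<Sum>s\<in>S. t s a b e)" for a b e
  have "(\<Sum>s\<in>S. c s * x ^ i s * y ^ j s * z ^ k s) =
      (\<Sum>a\<le>d. \<Sum>b\<le>d. \<Sum>e\<le>d. c' a b e * x ^ a * y ^ b * z ^ e)" for x y z
  proof -
    have "(\<Sum>a\<le>d. \<Sum>b\<le>d. \<Sum>e\<le>d. c' a b e * x ^ a * y ^ b * z ^ e) =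
        (\<Sum>a\<le>d. \<Sum>b\<le>d. \<Sum>e\<le>d. \<Sum>s\<in>S. t s a b e * x ^ a * y ^ b * z ^ e)"
      by (simp add: c'_def sum_distrib_right)
    also have "\<dots> = (\<Sum>s\<in>S. \<Sum>a\<le>d. \<Sum>b\<le>d. \<Sum>e\<le>d. t s a b e * x ^ a * y ^ b * z ^ e)"
      by (simp only: sum.swap[of _ S])
    also have "\<dots> = (\<Sum>s\<in>S. c s * x ^ i s * y ^ j s * z ^ k s)"
      using d unfolding t_def
      by (intro sum.cong refl) (simp add: if_distribR if_distrib[of "\<lambda>u. u * _"] sum.delta cong: if_cong)
    finally show ?thesis ..
  qed
  then show ?thesis unfolding polynomial3_def by blast
qed

lemma polynomial3E:
  assumes "polynomial3 f"
  obtains d c where "f = (\<lambda>x y z. \<Sum>(i, j, k)\<in>{..d} \<times> {..d} \<times> {..d}. c i j k * x ^ i * y ^ j * z ^ k)"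
proof -
  obtain d c where "\<forall>x y z. f x y z = (\<Sum>i\<le>d. \<Sum>j\<le>d. \<Sum>k\<le>d. c i j k * x ^ i * y ^ j * z ^ k)"
    using assms unfolding polynomial3_def by blast
  then show thesis
    by (intro that[of c d] ext) (simp add: sum.cartesian_product)
qed

lemma polynomial3_const: "polynomial3 (\<lambda>x y z. c)"
  using polynomial3_sum_monomials[of "{()}" "\<lambda>_. c" "\<lambda>_. 0" "\<lambda>_. 0" "\<lambda>_. 0"] by simp

lemma polynomial3_vars:
  "polynomial3 (\<lambda>x y z. x)" "polynomial3 (\<lambda>x y z. y)" "polynomial3 (\<lambda>x y z. z)"
  using polynomial3_sum_monomials[of "{()}" "\<lambda>_. 1" "\<lambda>_. 1" "\<lambda>_. 0" "\<lambda>_. 0"]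
    polynomial3_sum_monomials[of "{()}" "\<lambda>_. 1" "\<lambda>_. 0" "\<lambda>_. 1" "\<lambda>_. 0"]
    polynomial3_sum_monomials[of "{()}" "\<lambda>_. 1" "\<lambda>_. 0" "\<lambda>_. 0" "\<lambda>_. 1"] by simp_all

text \<open>The disjoint union of the two index sets lists the monomials of both summands.\<close>

lemma polynomial3_add:
  assumes "polynomial3 f" "polynomial3 g"
  shows "polynomial3 (\<lambda>x y z. f x y z + g x y z)"
proof -
  obtain d c where f: "f = (\<lambda>x y z. \<Sum>(i, j, k)\<in>{..d} \<times> {..d} \<times> {..d}. c i j k * x ^ i * y ^ j * z ^ k)"
    using assms(1) by (rule polynomial3E)
  obtain d' c' where g: "g = (\<lambda>x y z. \<Sum>(i, j, k)\<in>{..d'} \<times> {..d'} \<times> {..d'}. c' i j k * x ^ i * y ^ j * z ^ k)"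
    using assms(2) by (rule polynomial3E)
  let ?S = "({..d} \<times> {..d} \<times> {..d}) <+> ({..d'} \<times> {..d'} \<times> {..d'})"
  let ?t = "\<lambda>s. case s of Inl t \<Rightarrow> t | Inr t \<Rightarrow> t"
  have "f x y z + g x y z = (\<Sum>s\<in>?S. (case s of Inl (i, j, k) \<Rightarrow> c i j k | Inr (i, j, k) \<Rightarrow> c' i j k) *
      x ^ fst (?t s) * y ^ fst (snd (?t s)) * z ^ snd (snd (?t s)))" for x y z
    by (simp add: f g sum.Plus case_prod_beta)
  then show ?thesis
    using polynomial3_sum_monomials[of ?S] by simp
qed

text \<open>Distributing the product gives one monomial for each pair of indices, with exponents
  added.\<close>

lemma polynomial3_mult:
  assumes "polynomial3 f" "polynomial3 g"
  shows "polynomial3 (\<lambda>x y z. f x y z * g x y z)"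
proof -
  obtain d c where f: "f = (\<lambda>x y z. \<Sum>(i, j, k)\<in>{..d} \<times> {..d} \<times> {..d}. c i j k * x ^ i * y ^ j * z ^ k)"
    using assms(1) by (rule polynomial3E)
  obtain d' c' where g: "g = (\<lambda>x y z. \<Sum>(i, j, k)\<in>{..d'} \<times> {..d'} \<times> {..d'}. c' i j k * x ^ i * y ^ j * z ^ k)"
    using assms(2) by (rule polynomial3E)
  let ?S = "({..d} \<times> {..d} \<times> {..d}) \<times> ({..d'} \<times> {..d'} \<times> {..d'})"
  have "f x y z * g x y z = (\<Sum>s\<in>?S. (case s of ((i, j, k), (i', j', k')) \<Rightarrow> c i j k * c' i' j' k') *
      x ^ (fst (fst s) + fst (snd s)) * y ^ (fst (snd (fst s)) + fst (snd (snd s))) *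
      z ^ (snd (snd (fst s)) + snd (snd (snd s))))" for x y z
    unfolding f g sum_product sum.cartesian_product
    by (rule sum.cong) (auto simp: power_add)
  then show ?thesis
    using polynomial3_sum_monomials[of ?S] by simp
qed

lemma polynomial3_power: "polynomial3 f \<Longrightarrow> polynomial3 (\<lambda>x y z. f x y z ^ m)"
  by (induction m) (auto intro: polynomial3_const polynomial3_mult)

lemmas polynomial3_intros =
  polynomial3_const polynomial3_vars polynomial3_add polynomial3_mult polynomial3_power

section \<open>Choice of the parameters\<close>

theorem lemma3:
  "\<exists>Q\<^sub>K Q\<^sub>T :: real \<Rightarrow> real \<Rightarrow> real \<Rightarrow> real. \<exists>Q\<^sub>b :: real poly.
     polynomial3 Q\<^sub>K \<and> polynomial3 Q\<^sub>T \<and>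
     (\<forall>(n::nat) (V :: nat \<Rightarrow> real measure) (\<epsilon>::real) (\<tau>::real).
        (\<forall>i\<in>{1..n}. valuation_distribution (V i)) \<and> \<epsilon> > 0 \<and> \<tau> > 0 \<longrightarrow>
        (\<exists>K b :: nat. K > 0 \<and> b > 0 \<and>
           real K \<le> Q\<^sub>K (real n) (1 / \<epsilon>) (ln (1 / \<tau>)) \<and>
           real b \<le> poly Q\<^sub>b (1 / \<epsilon>) \<and>
           \<P>(\<omega> in sample_space n K V.
               \<forall>\<sigma> p r. result (find_apx_prices \<sigma> \<omega> n K b) = (p, r) \<longrightarrow>
                 Rev n V p \<ge> (SUP p'\<in>price_vectors n. Rev n V p') - \<epsilon> \<and>
                 r \<in> {Rev n V p - \<epsilon> .. Rev n V p + \<epsilon>}) \<ge> 1 - \<tau> \<and>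
           (\<forall>\<sigma> \<omega>. real (steps (find_apx_prices \<sigma> \<omega> n K b)) \<le> Q\<^sub>T (real n) (1 / \<epsilon>) (ln (1 / \<tau>)))))"
proof -
  \<comment> \<open>This is \<open>C\<close> below with \<open>b\<close> replaced by its bound
    \<open>2 * x + 1\<close>, plus 1 for rounding up. The square of \<open>z\<close> keeps it
    positive when \<open>\<tau> > 1\<close> makes the logarithm negative.\<close>
  define Q\<^sub>K :: "real \<Rightarrow> real \<Rightarrow> real \<Rightarrow> real" where
    "Q\<^sub>K n x z = 8 * (n + 1)\<^sup>2 * x\<^sup>2 * (2 * n * (2 * x + 2) + 1 + z\<^sup>2) + 1" for n x z
  define Q\<^sub>b :: "real poly" where "Q\<^sub>b = [:1, 2:]"
  define Q\<^sub>T :: "real \<Rightarrow> real \<Rightarrow> real \<Rightarrow> real" where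
    "Q\<^sub>T n x z = n * ((2 * x + 2) * (2 * Q\<^sub>K n x z + 11) + 4 * Q\<^sub>K n x z + 6) + 2" for n x z
  have "\<exists>K b :: nat. K > 0 \<and> b > 0 \<and>
           real K \<le> Q\<^sub>K (real n) (1 / \<epsilon>) (ln (1 / \<tau>)) \<and>
           real b \<le> poly Q\<^sub>b (1 / \<epsilon>) \<and>
           \<P>(\<omega> in sample_space n K V.
               \<forall>\<sigma> p r. result (find_apx_prices \<sigma> \<omega> n K b) = (p, r) \<longrightarrow>
                 Rev n V p \<ge> (SUP p'\<in>price_vectors n. Rev n V p') - \<epsilon> \<and>
                 r \<in> {Rev n V p - \<epsilon> .. Rev n V p + \<epsilon>}) \<ge> 1 - \<tau> \<and>
           (\<forall>\<sigma> \<omega>. real (steps (find_apx_prices \<sigma> \<omega> n K b)) \<le> Q\<^sub>T (real n) (1 / \<epsilon>) (ln (1 / \<tau>)))"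
    if V: "\<forall>i\<in>{1..n}. valuation_distribution (V i)" and "\<epsilon> > 0" "\<tau> > 0"
    for n :: nat and V :: "nat \<Rightarrow> real measure" and \<epsilon> \<tau> :: real
  proof -
    define x z where "x = 1 / \<epsilon>" and "z = ln (1 / \<tau>)"
    \<comment> \<open>Leaves half of \<epsilon> for rounding; \<open>n + 1\<close> avoids a zero
      denominator without buyers.\<close>
    define \<delta> where "\<delta> = \<epsilon> / (4 * (real n + 1))"
    define b where "b = nat \<lceil>2 * x\<rceil>"
    \<comment> \<open>The factor in front of the exponential in the union bound. \<open>C\<close> is
      the sample size for which \<open>2 * C * \<delta>\<^sup>2\<close> equals
      \<open>A + 1 + z\<^sup>2\<close>.\<close>
    define A where "A = 2 * real n * (real b + 1)"
    define C where "C = 8 * (real n + 1)\<^sup>2 * x\<^sup>2 * (A + 1 + z\<^sup>2)"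
    define K where "K = nat \<lceil>C\<rceil>"
    have "x > 0" "\<delta> > 0" "A \<ge> 0" using \<open>\<epsilon> > 0\<close> by (auto simp: x_def \<delta>_def A_def)
    have "A + 1 + z\<^sup>2 > 0" using \<open>A \<ge> 0\<close> by (smt (verit) zero_le_power2)
    then have "C > 0"
      using \<open>x > 0\<close> unfolding C_def by (intro mult_pos_pos) auto
    have b: "b > 0" "2 * x \<le> real b" "real b \<le> 2 * x + 1"
      using \<open>x > 0\<close> unfolding b_def by linarith+
    have K: "K > 0" "C \<le> real K" "real K \<le> C + 1"
      using \<open>C > 0\<close> unfolding K_def by linarith+
    have "A \<le> 2 * real n * (2 * x + 2)"
      using b(3) unfolding A_def by (intro mult_left_mono) auto
    then have "C \<le> 8 * (real n + 1)\<^sup>2 * x\<^sup>2 * (2 * real n * (2 * x + 2) + 1 + z\<^sup>2)"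
      unfolding C_def by (intro mult_left_mono) auto
    with K(3) have KQ: "real K \<le> Q\<^sub>K (real n) x z" by (simp add: Q\<^sub>K_def)
    have bQ: "real b \<le> poly Q\<^sub>b x" using b(3) by (simp add: Q\<^sub>b_def)

    have "1 / real b \<le> \<epsilon> / 2"
      using b(1,2) \<open>\<epsilon> > 0\<close> by (simp add: x_def field_simps)
    moreover have "2 * real n * \<delta> \<le> \<epsilon> / 2"
      using \<open>\<epsilon> > 0\<close> by (simp add: \<delta>_def field_simps)
    ultimately have "1 / real b + 2 * real n * \<delta> \<le> \<epsilon>" by linarith
    note prob = find_apx_prices_prob[of n V, OF bspec[OF V] K(1) b(1) less_imp_le[OF \<open>\<delta> > 0\<close>] this]

    have "4 * (real n + 1) * x * \<delta> = 1"
      using \<open>\<epsilon> > 0\<close> by (simp add: \<delta>_def x_def)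
    then have "A + 1 + z\<^sup>2 = (4 * (real n + 1) * x * \<delta>)\<^sup>2 * (A + 1 + z\<^sup>2)" by simp
    also have "\<dots> = 2 * C * \<delta>\<^sup>2"
      unfolding C_def by algebra
    also have "\<dots> \<le> 2 * real K * \<delta>\<^sup>2"
      using K(2) by (intro mult_right_mono) auto
    finally have "A + 1 + z\<^sup>2 \<le> 2 * real K * \<delta>\<^sup>2" .
    moreover have "0 \<le> (z - 1)\<^sup>2 + z\<^sup>2 + 1" by simp
    then have "z \<le> 1 + z\<^sup>2" by (simp add: power2_diff)
    ultimately have "A + z \<le> 2 * real K * \<delta>\<^sup>2" by linarith
    \<comment> \<open>Absorbing \<open>A\<close> into \<open>exp A\<close> costs a term
      \<open>A\<close> in the exponent instead of its logarithm, which keeps \<open>K\<close>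
      polynomial and also covers \<open>A = 0\<close>.\<close>
    moreover have "A \<le> exp A" using exp_ge_add_one_self[of A] by linarith
    ultimately have "A * exp (- 2 * real K * \<delta>\<^sup>2) \<le> exp A * exp (- (A + z))"
      using \<open>A \<ge> 0\<close> by (intro mult_mono) auto
    also have "\<dots> = \<tau>"
      using \<open>\<tau> > 0\<close> by (simp add: z_def ln_div exp_minus flip: exp_add)
    finally have "2 * real n * (real b + 1) * exp (- 2 * real K * \<delta>\<^sup>2) \<le> \<tau>"
      by (simp add: A_def)
    then have "1 - \<tau> \<le> 1 - 2 * real n * (real b + 1) * exp (- 2 * real K * \<delta>\<^sup>2)" by linarith
    note prob = order.trans[OF this prob]

    have steps: "real (steps (find_apx_prices \<sigma> \<omega> n K b)) \<le> Q\<^sub>T (real n) x z" for \<sigma> \<omega>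
    proof -
      have "(real b + 1) * (2 * real K + 11) \<le> (2 * x + 2) * (2 * Q\<^sub>K (real n) x z + 11)"
        using KQ b(3) \<open>x > 0\<close> by (intro mult_mono) auto
      then have le: "(real b + 1) * (2 * real K + 11) + 4 * real K + 6 \<le>
          (2 * x + 2) * (2 * Q\<^sub>K (real n) x z + 11) + 4 * Q\<^sub>K (real n) x z + 6"
        using KQ by linarith
      have "real (steps (find_apx_prices \<sigma> \<omega> n K b)) =
          real n * ((real b + 1) * (2 * real K + 11) + 4 * real K + 6) + 2"
        by (simp add: steps_find_apx_prices algebra_simps)
      also have "\<dots> \<le> Q\<^sub>T (real n) x z"
        unfolding Q\<^sub>T_def using mult_left_mono[OF le, of "real n"] by simp
      finally show ?thesis .
    qed
    show ?thesis
      using K(1) b(1) KQ bQ prob steps unfolding x_def z_def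
      by (intro exI[of _ K] exI[of _ b] conjI allI)
  qed
  moreover have "polynomial3 Q\<^sub>K" "polynomial3 Q\<^sub>T"
    unfolding Q\<^sub>T_def Q\<^sub>K_def by (intro polynomial3_intros)+
  ultimately show ?thesis by blast
qed

end
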